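(* Let $(S,\mathcal{S})$ be a Borel space, $\mu$ an atomless and $\sigma$-finite measure on $S$, and $\xi$ an almost surely diffuse random measure on $S$ such that the intensity measure $\mathbf{E}\,\xi$ is $\sigma$-finite. Then $\xi$ is $\mu$-swap-invariant if and only if $\xi=\alpha\mu$ almost surely for some $[0,\infty)$-valued integrable random variable $\alpha$.
   Context: A random measure $\xi$ on a measurable space $(S,\mathcal{S})$, defined over a probability space $(\Omega,\mathcal{F},\mathbf{P})$, is a map $\xi:\Omega\times\mathcal{S}\to[0,\infty]$ such that $\xi(M)=\xi(\cdot,M)$ is measurable for each $M\in\mathcal{S}$ and $\xi(\omega,\cdot)$ is a measure for each $\omega\in\Omega$. Its intensity measure $\mathbf{E}\,\xi$ is $M\mapsto\mathbf{E}\,\xi(M)$. A measurable space $(S,\mathcal{S})$ is a Borel space if there is a bijection, measurable with measurable inverse, from $S$ onto a Borel subset of $[0,1]$. A measure $\mu$ on a Borel space $S$ is diffuse if $\mu(\{s\})=0$ for each $s\in S$. Atomless: an atom of $\mu$ is a measurable set $M$ with $\mu(M)>0$ such that every measurable $C\subset M$ satisfies $\mu(C)=0$ or $\mu(C)=\mu(M)$; $\mu$ is atomless if it has no atoms. $\mu$-swap-invariant: $\mathbf{E}\,\big|\sum_{j=1}^n u_j\xi(A_j)\big|=\mathbf{E}\,\big|\sum_{j=1}^n u_j\xi(B_j)\big|$ for all $n\ge1$, $u\in\mathbb{R}^n$, disjoint $A_1,\dots,A_n\in\mathcal{S}$ and disjoint $B_1,\dots,B_n\in\mathcal{S}$ such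 that $\mu(A_j)=\mu(B_j)$, $\mathbf{E}\,\xi(A_j)<\infty$ and $\mathbf{E}\,\xi(B_j)<\infty$ for $1\le j\le n$. *)

theory Defs
  imports "HOL-Probability.Probability"
begin

definition borel_isomorphic_space :: "'a measure \<Rightarrow> bool" where
  "borel_isomorphic_space S \<longleftrightarrow>
     (\<exists>(B :: real set) f. B \<in> sets borel \<and> B \<subseteq> {0..1} \<and> bij_betw f (space S) B \<and>
        f \<in> measurable S (restrict_space borel B) \<and>
        inv_into (space S) f \<in> measurable (restrict_space borel B) S)"

definition random_measure :: "'w measure \<Rightarrow> 'a measure \<Rightarrow> ('w \<Rightarrow> 'a measure) \<Rightarrow> bool" where
  "random_measure P S \<xi> \<longleftrightarrow>
     (\<forall>\<omega>\<in>space P. sets (\<xi> \<omega>) = sets S) \<and>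
     (\<forall>M\<in>sets S. (\<lambda>\<omega>. emeasure (\<xi> \<omega>) M) \<in> borel_measurable P)"

definition intensity_measure :: "'w measure \<Rightarrow> 'a measure \<Rightarrow> ('w \<Rightarrow> 'a measure) \<Rightarrow> 'a measure" where
  "intensity_measure P S \<xi> =
     measure_of (space S) (sets S) (\<lambda>M. \<integral>\<^sup>+ \<omega>. emeasure (\<xi> \<omega>) M \<partial>P)"

text \<open>
  The set function in the previous definition is countably additive, so
  \<^const>\<open>measure_of\<close> does not fall back to the zero measure.
\<close>

lemma emeasure_intensity_measure:
  fixes S :: "'a measure"
  assumes "random_measure P S \<xi>" "M \<in> sets S"
  shows "emeasure (intensity_measure P S \<xi>) M = (\<integral>\<^sup>+ \<omega>. emeasure (\<xi> \<omega>) M \<partial>P)"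
proof (rule emeasure_measure_of[OF intensity_measure_def])
  have st: "\<And>\<omega>. \<omega> \<in> space P \<Longrightarrow> sets (\<xi> \<omega>) = sets S"
    and me: "\<And>M. M \<in> sets S \<Longrightarrow> (\<lambda>\<omega>. emeasure (\<xi> \<omega>) M) \<in> borel_measurable P"
    using assms(1) by (auto simp: random_measure_def)
  show "sets S \<subseteq> Pow (space S)"
    by (rule sets.space_closed)
  show "M \<in> sets (intensity_measure P S \<xi>)"
    using assms(2) by (simp add: intensity_measure_def)
  show "positive (sets (intensity_measure P S \<xi>)) (\<lambda>M. \<integral>\<^sup>+ \<omega>. emeasure (\<xi> \<omega>) M \<partial>P)"
    by (simp add: positive_def)
  show "countably_additive (sets (intensity_measure P S \<xi>)) (\<lambda>M. \<integral>\<^sup>+ \<omega>. emeasure (\<xi> \<omega>) M \<partial>P)"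
  proof (rule countably_additiveI)
    fix A :: "nat \<Rightarrow> 'a set"
    assume "range A \<subseteq> sets (intensity_measure P S \<xi>)" and d: "disjoint_family A"
    then have A: "range A \<subseteq> sets S"
      by (simp add: intensity_measure_def)
    have "(\<Sum>i. \<integral>\<^sup>+ \<omega>. emeasure (\<xi> \<omega>) (A i) \<partial>P) = (\<integral>\<^sup>+ \<omega>. (\<Sum>i. emeasure (\<xi> \<omega>) (A i)) \<partial>P)"
      using A by (intro nn_integral_suminf[symmetric] me) auto
    also have "\<dots> = (\<integral>\<^sup>+ \<omega>. emeasure (\<xi> \<omega>) (\<Union>i. A i) \<partial>P)"
      using A d by (intro nn_integral_cong suminf_emeasure) (simp_all add: st)
    finally show "(\<Sum>i. \<integral>\<^sup>+ \<omega>. emeasure (\<xi> \<omega>) (A i) \<partial>P) = (\<integral>\<^sup>+ \<omega>. emeasure (\<xi> \<omega>) (\<Union>i. A i) \<partial>P)" .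
  qed
qed

text \<open>Intended for measures on Borel spaces, in which singletons are measurable.\<close>

definition diffuse :: "'a measure \<Rightarrow> bool" where
  "diffuse M \<longleftrightarrow> (\<forall>s\<in>space M. emeasure M {s} = 0)"

definition atom :: "'a measure \<Rightarrow> 'a set \<Rightarrow> bool" where
  "atom \<mu> M \<longleftrightarrow> M \<in> sets \<mu> \<and> emeasure \<mu> M > 0 \<and>
     (\<forall>C\<in>sets \<mu>. C \<subseteq> M \<longrightarrow> emeasure \<mu> C = 0 \<or> emeasure \<mu> C = emeasure \<mu> M)"

definition atomless :: "'a measure \<Rightarrow> bool" where
  "atomless \<mu> \<longleftrightarrow> (\<nexists>M. atom \<mu> M)"

text \<open>
  The linear combinations use the real-valued \<^const>\<open>measure\<close>, which is 0 where the
  measure is infinite. Since the sets involved have finite expected mass, this concerns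
  only a null event, and the expectations below are of integrable variables.
\<close>

definition swap_invariant ::
    "'w measure \<Rightarrow> 'a measure \<Rightarrow> 'a measure \<Rightarrow> ('w \<Rightarrow> 'a measure) \<Rightarrow> bool" where
  "swap_invariant P S \<mu> \<xi> \<longleftrightarrow>
     (\<forall>(n :: nat) (u :: nat \<Rightarrow> real) A B.
        n \<ge> 1 \<longrightarrow>
        (\<forall>j\<in>{1..n}. A j \<in> sets S \<and> B j \<in> sets S) \<longrightarrow>
        disjoint_family_on A {1..n} \<longrightarrow> disjoint_family_on B {1..n} \<longrightarrow>
        (\<forall>j\<in>{1..n}. emeasure \<mu> (A j) = emeasure \<mu> (B j) \<and>
           (\<integral>\<^sup>+ \<omega>. emeasure (\<xi> \<omega>) (A j) \<partial>P) < \<infinity> \<and>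
           (\<integral>\<^sup>+ \<omega>. emeasure (\<xi> \<omega>) (B j) \<partial>P) < \<infinity>) \<longrightarrow>
        (\<integral>\<omega>. \<bar>\<Sum>j=1..n. u j * measure (\<xi> \<omega>) (A j)\<bar> \<partial>P) =
        (\<integral>\<omega>. \<bar>\<Sum>j=1..n. u j * measure (\<xi> \<omega>) (B j)\<bar> \<partial>P))"

end

theory Submission imports Defs begin

text \<open>
  Only the pairs with coefficients 1 and -1 are needed. Let \<open>A\<close>, \<open>A'\<close> be disjoint with the same
  \<open>\<mu>\<close>-measure and cut \<open>A \<union> A'\<close> into \<open>k\<close> cells along a measurable injection into \<open>(0, 1]\<close>; cut each cell
  into two halves \<open>L\<^sub>i\<close>, \<open>R\<^sub>i\<close> of equal \<open>\<mu>\<close>-measure. For every choice of signs, swap-invariance gives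
  \<open>E |\<xi> A - \<xi> A'| = E |\<Sum>\<^sub>i \<plusminus> (\<xi> L\<^sub>i - \<xi> R\<^sub>i)|\<close>. Averaging over the signs bounds this by the expectation of the
  \<open>l\<^sup>2\<close>-norm of the \<open>\<xi>\<close>-masses of the cells, which tends to 0 by dominated convergence since \<open>\<xi>\<close> is
  diffuse. Hence sets of equal \<open>\<mu>\<close>-measure almost surely have equal \<open>\<xi>\<close>-measure, so \<open>\<xi> A\<close> is almost surely
  additive and monotone, hence linear, in \<open>\<mu> A\<close>; a countable generator makes the null set uniform in \<open>A\<close>.
\<close>

section \<open>Averages over all choices of signs\<close>

text \<open>A subset \<open>J\<close> of \<open>K\<close> encodes a choice of signs, and the mixed
  products cancel over all choices. The offset \<open>c\<close> makes the induction work: splitting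
  off \<open>x\<close> replaces it by \<open>c - d x\<close> and \<open>c + d x\<close>, whose
  squares add up to \<open>2 * (c\<^sup>2 + (d x)\<^sup>2)\<close>.\<close>

lemma sum_Pow_signed_sum_squared:
  fixes d :: "'i \<Rightarrow> real"
  assumes "finite K"
  shows "(\<Sum>J\<in>Pow K. (c + (\<Sum>i\<in>K. if i \<in> J then d i else - d i))\<^sup>2)
    = 2 ^ card K * (c\<^sup>2 + (\<Sum>i\<in>K. (d i)\<^sup>2))"
  using assms
proof (induction K arbitrary: c rule: finite_induct)
  case empty
  then show ?case by simp
next
  case (insert x K)
  let ?s = "\<lambda>J. \<Sum>i\<in>K. if i \<in> J then d i else - d i"
  let ?t = "\<lambda>J. \<Sum>i\<in>insert x K. if i \<in> J then d i else - d i"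
  have s_insert: "?s (insert x J) = ?s J" for J
    using insert.hyps by (intro sum.cong) auto
  have "(\<Sum>J\<in>Pow (insert x K). (c + ?t J)\<^sup>2)
      = (\<Sum>J\<in>Pow K. (c + ?t J)\<^sup>2) + (\<Sum>J\<in>insert x ` Pow K. (c + ?t J)\<^sup>2)"
    unfolding Pow_insert using insert.hyps by (intro sum.union_disjoint) auto
  also have "(\<Sum>J\<in>Pow K. (c + ?t J)\<^sup>2) = (\<Sum>J\<in>Pow K. ((c - d x) + ?s J)\<^sup>2)"
    using insert.hyps by (intro sum.cong) (auto simp: algebra_simps)
  also have "(\<Sum>J\<in>insert x ` Pow K. (c + ?t J)\<^sup>2) = (\<Sum>J\<in>Pow K. ((c + d x) + ?s J)\<^sup>2)"
  proof (subst sum.reindex)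
    show "inj_on (insert x) (Pow K)"
      using insert.hyps by (auto simp: inj_on_def)
    show "sum ((\<lambda>J. (c + ?t J)\<^sup>2) \<circ> insert x) (Pow K) = (\<Sum>J\<in>Pow K. ((c + d x) + ?s J)\<^sup>2)"
      using insert.hyps s_insert by (intro sum.cong) (auto simp: algebra_simps)
  qed
  finally show ?case
    unfolding insert.IH using insert.hyps by (simp add: power2_eq_square algebra_simps)
qed

text \<open>Cauchy-Schwarz over the \<open>2 ^ card K\<close> sign choices reduces the first
  absolute moment to the second moment; this is the elementary half of Khintchine's
  inequality.\<close>

lemma sum_Pow_abs_signed_sum_le:
  fixes d :: "'i \<Rightarrow> real"
  assumes "finite K"
  shows "(\<Sum>J\<in>Pow K. \<bar>\<Sum>i\<in>K. if i \<in> J then d i else - d i\<bar>)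
    \<le> 2 ^ card K * sqrt (\<Sum>i\<in>K. (d i)\<^sup>2)"
proof -
  let ?s = "\<lambda>J. \<Sum>i\<in>K. if i \<in> J then d i else - d i"
  have "(\<Sum>J\<in>Pow K. \<bar>?s J\<bar>)\<^sup>2 \<le> (\<Sum>J\<in>Pow K. \<bar>?s J\<bar>\<^sup>2) * card (Pow K)"
    by (rule sum_squared_le_sum_of_squares)
  also have "\<dots> = (2 ^ card K)\<^sup>2 * (\<Sum>i\<in>K. (d i)\<^sup>2)"
    using sum_Pow_signed_sum_squared[OF assms, of 0 d] assms
    by (simp add: card_Pow power2_eq_square)
  finally have "(\<Sum>J\<in>Pow K. \<bar>?s J\<bar>) \<le> sqrt ((2 ^ card K)\<^sup>2 * (\<Sum>i\<in>K. (d i)\<^sup>2))"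
    by (rule real_le_rsqrt)
  then show ?thesis
    by (simp add: real_sqrt_mult)
qed

section \<open>Fine partitions of the unit interval\<close>

text \<open>The sum of squares is at most the largest cell mass times the total mass. Without point
  masses the distribution function is continuous, hence uniformly continuous on
  \<open>{0..1}\<close>, so the largest cell mass tends to 0.\<close>

lemma sum_measure_cells_squared_tendsto_0:
  fixes N :: "real measure"
  assumes "finite_borel_measure N" and null: "\<And>x. measure N {x} = 0"
  shows "(\<lambda>k. \<Sum>i<k. (measure N {real i / k<..real (Suc i) / k})\<^sup>2) \<longlonglongrightarrow> 0"
proof -
  interpret finite_borel_measure N by fact
  let ?m = "measure N UNIV"
  let ?I = "\<lambda>k i. {real i / real k<..real (Suc i) / real k}"
  have "continuous_on {0..1} (cdf N)"
    by (intro continuous_at_imp_continuous_on) (simp add: isCont_cdf null)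
  then have uc: "uniformly_continuous_on {0..1} (cdf N)"
    by (rule compact_uniformly_continuous) simp
  have bound: "\<forall>\<^sub>F k in sequentially. (\<Sum>i<k. (measure N (?I k i))\<^sup>2) \<le> e * ?m" if "e > 0" for e
  proof -
    obtain \<delta> where \<delta>: "\<delta> > 0"
      "\<And>x y. x \<in> {0..1} \<Longrightarrow> y \<in> {0..1} \<Longrightarrow> dist x y < \<delta> \<Longrightarrow> dist (cdf N x) (cdf N y) < e"
      using uc \<open>e > 0\<close> unfolding uniformly_continuous_on_def by metis
    have "\<forall>\<^sub>F k in sequentially. 1 / real k < \<delta>"
      using lim_1_over_n[where 'a = real] \<delta>(1) by (rule order_tendstoD)
    moreover have "\<forall>\<^sub>F k::nat in sequentially. k > 0"
      by (rule eventually_gt_at_top)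
    ultimately show ?thesis
    proof eventually_elim
      case (elim k)
      have small: "measure N (?I k i) \<le> e" if "i < k" for i
      proof -
        have lt: "real i / k < real (Suc i) / k"
          using elim by (simp add: field_simps)
        have "dist (real (Suc i) / k) (real i / k) < \<delta>"
          using elim by (simp add: dist_real_def field_simps)
        moreover have "real (Suc i) / k \<in> {0..1}" "real i / k \<in> {0..1}"
          using that by (auto simp: field_simps)
        ultimately have "dist (cdf N (real (Suc i) / k)) (cdf N (real i / k)) < e"
          by (intro \<delta>)
        then show ?thesis
          using cdf_diff_eq[OF lt] by (simp add: dist_real_def)
      qed
      have disj: "disjoint_family_on (?I k) {..<k}"
      proof (unfold disjoint_family_on_def, intro ballI impI)
        fix i j assume "i \<in> {..<k}" "j \<in> {..<k}" "i \<noteq> j"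
        then consider "Suc i \<le> j" | "Suc j \<le> i" by linarith
        then show "?I k i \<inter> ?I k j = {}"
        proof cases
          case 1
          then have "real (Suc i) / k \<le> real j / k"
            by (intro divide_right_mono) auto
          then show ?thesis by auto
        next
          case 2
          then have "real (Suc j) / k \<le> real i / k"
            by (intro divide_right_mono) auto
          then show ?thesis by auto
        qed
      qed
      have "(\<Sum>i<k. (measure N (?I k i))\<^sup>2) \<le> (\<Sum>i<k. e * measure N (?I k i))"
        using small by (intro sum_mono) (auto simp: power2_eq_square intro: mult_right_mono)
      also have "\<dots> = e * measure N (\<Union>i<k. ?I k i)"
        using disj by (subst finite_measure_finite_Union) (auto simp: sum_distrib_left)
      also have "\<dots> \<le> e * ?m"
        using \<open>e > 0\<close> bounded_measure[of "\<Union>i<k. ?I k i"]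
        by (intro mult_left_mono) (auto simp: borel_UNIV)
      finally show ?case .
    qed
  qed
  show ?thesis
  proof (rule tendstoI)
    fix r :: real assume "r > 0"
    \<comment> \<open>The added 1 keeps the denominator positive when \<open>?m\<close> is 0, and
      the factor 2 makes the final bound strict.\<close>
    define e where "e = r / (2 * (?m + 1))"
    have m: "?m \<ge> 0" by simp
    then have m1: "?m + 1 > 0" by linarith
    have "e > 0"
      using \<open>r > 0\<close> m1 unfolding e_def by simp
    have "e * ?m \<le> e * (?m + 1)"
      using \<open>e > 0\<close> by simp
    also have "\<dots> = r / 2"
      using m1 unfolding e_def by (simp add: divide_simps)
    finally have "e * ?m < r" using \<open>r > 0\<close> by linarith
    with bound[OF \<open>e > 0\<close>]
    show "\<forall>\<^sub>F k in sequentially. dist (\<Sum>i<k. (measure N (?I k i))\<^sup>2) 0 < r"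
      by (auto elim!: eventually_mono simp: sum_nonneg)
  qed
qed

section \<open>Transport to the real line\<close>

text \<open>The restriction of \<open>M\<close> to \<open>A\<close>, pushed to the line, where
  distribution functions are available. Restricting by a density keeps the sigma-algebra of
  \<open>M\<close>, so the measurability of \<open>f\<close> carries over unchanged.\<close>

definition trace_distr :: "'a measure \<Rightarrow> 'a set \<Rightarrow> ('a \<Rightarrow> real) \<Rightarrow> real measure" where
  "trace_distr M A f = distr (density M (indicator A)) borel f"

lemma emeasure_trace_distr:
  assumes [measurable]: "f \<in> borel_measurable M" "A \<in> sets M" "C \<in> sets borel"
  shows "emeasure (trace_distr M A f) C = emeasure M (A \<inter> f -` C)"
proof -
  have "A \<inter> (f -` C \<inter> space M) = A \<inter> f -` C"
    using sets.sets_into_space[OF assms(2)] by auto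
  moreover have "f -` C \<inter> space M \<in> sets M"
    by measurable
  ultimately show ?thesis
    unfolding trace_distr_def by (simp add: emeasure_distr emeasure_restricted)
qed

lemma measure_trace_distr:
  assumes "f \<in> borel_measurable M" "A \<in> sets M" "C \<in> sets borel"
  shows "measure (trace_distr M A f) C = measure M (A \<inter> f -` C)"
  using emeasure_trace_distr[OF assms] by (simp add: measure_def)

lemma finite_borel_measure_trace_distr:
  assumes "f \<in> borel_measurable M" "A \<in> sets M" "emeasure M A < \<infinity>"
  shows "finite_borel_measure (trace_distr M A f)"
proof (intro finite_borel_measure.intro finite_measureI finite_borel_measure_axioms.intro)
  show "sets (trace_distr M A f) = sets borel"
    by (simp add: trace_distr_def)
  have "space (trace_distr M A f) = UNIV"
    by (simp add: trace_distr_def)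
  then show "emeasure (trace_distr M A f) (space (trace_distr M A f)) \<noteq> \<infinity>"
    using assms emeasure_trace_distr[OF assms(1,2), of UNIV] by simp
qed

lemma emeasure_fiber_eq_0:
  assumes "inj_on f (space M)" "\<And>s. s \<in> space M \<Longrightarrow> emeasure M {s} = 0" "A \<in> sets M"
  shows "emeasure M (A \<inter> f -` {x}) = 0"
proof (cases "A \<inter> f -` {x} = {}")
  case False
  then obtain s where "s \<in> A" "f s = x" by auto
  moreover have "A \<subseteq> space M" using assms(3) by (rule sets.sets_into_space)
  ultimately have "A \<inter> f -` {x} = {s}" "s \<in> space M"
    using assms(1) by (auto simp: inj_on_def)
  then show ?thesis using assms(2) by simp
qed simp

lemma measure_trace_distr_singleton:
  assumes "f \<in> borel_measurable M" "inj_on f (space M)"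
    "\<And>s. s \<in> space M \<Longrightarrow> emeasure M {s} = 0" "A \<in> sets M"
  shows "measure (trace_distr M A f) {x} = 0"
  using emeasure_fiber_eq_0[OF assms(2,3,4)] measure_trace_distr[OF assms(1,4), of "{x}"]
  by (simp add: measure_def)

text \<open>Intermediate value theorem for the distribution function of the trace of
  \<open>M\<close> on \<open>A\<close>. Null singletons and the injectivity of \<open>f\<close> make
  it continuous; since \<open>f\<close> takes values in \<open>{0<..1}\<close>, it rises from 0 at 0
  to the full mass at 1.\<close>

lemma exists_cut:
  fixes f :: "'a \<Rightarrow> real"
  assumes f: "f \<in> borel_measurable M" "inj_on f (space M)" "f \<in> space M \<rightarrow> {0<..1}"
    and null: "\<And>s. s \<in> space M \<Longrightarrow> emeasure M {s} = 0"
    and A: "A \<in> sets M" "emeasure M A < \<infinity>"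
    and s: "0 \<le> s" "s \<le> measure M A"
  obtains A' where "A' \<in> sets M" "A' \<subseteq> A" "measure M A' = s"
proof -
  let ?N = "trace_distr M A f"
  interpret finite_borel_measure ?N
    using f A by (intro finite_borel_measure_trace_distr) auto
  have cdf: "cdf ?N t = measure M (A \<inter> f -` {..t})" for t
    using f A by (simp add: cdf_def measure_trace_distr)
  have AS: "A \<subseteq> space M" using A by (simp add: sets.sets_into_space)
  have "0 < f x" "f x \<le> 1" if "x \<in> A" for x
    using AS f(3) that by auto
  then have "A \<inter> f -` {..0} = {}" "A \<inter> f -` {..1} = A"
    by force+
  then have "cdf ?N 0 = 0" "cdf ?N 1 = measure M A"
    by (simp_all add: cdf)
  moreover have "isCont (cdf ?N) t" for t
    using measure_trace_distr_singleton[OF f(1,2) null A(1)] by (simp add: isCont_cdf)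
  ultimately obtain t where "cdf ?N t = s"
    using IVT[of "cdf ?N" 0 s 1] s by auto
  moreover have "A \<inter> f -` {..t} \<in> sets M"
  proof -
    have "A \<inter> (f -` {..t} \<inter> space M) \<in> sets M"
      using f(1) A(1) by (intro sets.Int measurable_sets) auto
    also have "A \<inter> (f -` {..t} \<inter> space M) = A \<inter> f -` {..t}" using AS by auto
    finally show ?thesis .
  qed
  ultimately show thesis
    using cdf by (intro that) auto
qed

section \<open>Swap-invariant random measures and tame sets\<close>

text \<open>The function \<open>f\<close> stands for the Borel isomorphism, adjusted to
  \<open>{0<..1}\<close>; by \<open>f_generates\<close>, a measure on the sigma-algebra of
  \<open>\<mu>\<close> is determined by its image under \<open>f\<close>. Atomlessness enters as
  \<open>null_\<mu>\<close>, and sigma-finiteness only at the end, as a partition into tame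
  sets.\<close>

locale swap_space =
  fixes P :: "'w measure" and \<mu> :: "'a measure" and \<xi> :: "'w \<Rightarrow> 'a measure" and f :: "'a \<Rightarrow> real"
  assumes f_measurable: "f \<in> borel_measurable \<mu>"
    and f_inj: "inj_on f (space \<mu>)"
    and f_range: "f \<in> space \<mu> \<rightarrow> {0<..1}"
    and f_generates: "A \<in> sets \<mu> \<Longrightarrow> \<exists>C\<in>sets borel. A = f -` C \<inter> space \<mu>"
    and null_\<mu>: "s \<in> space \<mu> \<Longrightarrow> emeasure \<mu> {s} = 0"
    and sets_\<xi>: "\<omega> \<in> space P \<Longrightarrow> sets (\<xi> \<omega>) = sets \<mu>"
    and \<xi>_measurable: "A \<in> sets \<mu> \<Longrightarrow> (\<lambda>\<omega>. emeasure (\<xi> \<omega>) A) \<in> borel_measurable P"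
    and diffuse_\<xi>: "AE \<omega> in P. diffuse (\<xi> \<omega>)"
    and swap: "\<lbrakk>A \<in> sets \<mu>; A' \<in> sets \<mu>; B \<in> sets \<mu>; B' \<in> sets \<mu>; A \<inter> A' = {}; B \<inter> B' = {};
      emeasure \<mu> A = emeasure \<mu> B; emeasure \<mu> A' = emeasure \<mu> B';
      (\<integral>\<^sup>+ \<omega>. emeasure (\<xi> \<omega>) A \<partial>P) < \<infinity>; (\<integral>\<^sup>+ \<omega>. emeasure (\<xi> \<omega>) A' \<partial>P) < \<infinity>;
      (\<integral>\<^sup>+ \<omega>. emeasure (\<xi> \<omega>) B \<partial>P) < \<infinity>; (\<integral>\<^sup>+ \<omega>. emeasure (\<xi> \<omega>) B' \<partial>P) < \<infinity>\<rbrakk> \<Longrightarrow>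
      (\<integral>\<omega>. \<bar>measure (\<xi> \<omega>) A - measure (\<xi> \<omega>) A'\<bar> \<partial>P) = (\<integral>\<omega>. \<bar>measure (\<xi> \<omega>) B - measure (\<xi> \<omega>) B'\<bar> \<partial>P)"
begin

text \<open>On these sets \<open>swap\<close> applies, \<open>measure \<mu>\<close> loses no
  information, and \<open>\<xi>\<close> is integrable and almost surely finite, so that masses may
  be subtracted.\<close>

definition tame :: "'a set set" where
  "tame = {A \<in> sets \<mu>. emeasure \<mu> A < \<infinity> \<and> (\<integral>\<^sup>+ \<omega>. emeasure (\<xi> \<omega>) A \<partial>P) < \<infinity>}"

lemma tame_sets: "A \<in> tame \<Longrightarrow> A \<in> sets \<mu>"
  by (simp add: tame_def)

lemma tame_fin: "A \<in> tame \<Longrightarrow> emeasure \<mu> A < \<infinity>"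
  by (simp add: tame_def)

lemma space_\<xi>: "\<omega> \<in> space P \<Longrightarrow> space (\<xi> \<omega>) = space \<mu>"
  using sets_\<xi> sets_eq_imp_space_eq by blast

lemma tame_subset:
  assumes "A \<in> tame" "C \<in> sets \<mu>" "C \<subseteq> A"
  shows "C \<in> tame"
proof -
  have "emeasure \<mu> C \<le> emeasure \<mu> A"
    using assms by (intro emeasure_mono) (auto simp: tame_def)
  moreover have "(\<integral>\<^sup>+ \<omega>. emeasure (\<xi> \<omega>) C \<partial>P) \<le> (\<integral>\<^sup>+ \<omega>. emeasure (\<xi> \<omega>) A \<partial>P)"
    using assms by (intro nn_integral_mono emeasure_mono) (auto simp: tame_def sets_\<xi>)
  ultimately show ?thesis
    using assms by (auto simp: tame_def)
qed

lemma tame_Un: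
  assumes "A \<in> tame" "C \<in> tame"
  shows "A \<union> C \<in> tame"
proof -
  have "emeasure \<mu> (A \<union> C) \<le> emeasure \<mu> A + emeasure \<mu> C"
    using assms by (intro emeasure_subadditive) (auto simp: tame_def)
  then have "emeasure \<mu> (A \<union> C) < \<infinity>"
    using assms by (auto simp: tame_def intro: order_le_less_trans)
  moreover have "(\<integral>\<^sup>+ \<omega>. emeasure (\<xi> \<omega>) (A \<union> C) \<partial>P)
      \<le> (\<integral>\<^sup>+ \<omega>. emeasure (\<xi> \<omega>) A + emeasure (\<xi> \<omega>) C \<partial>P)"
    using assms by (intro nn_integral_mono emeasure_subadditive) (auto simp: tame_def sets_\<xi>)
  then have "(\<integral>\<^sup>+ \<omega>. emeasure (\<xi> \<omega>) (A \<union> C) \<partial>P)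
      \<le> (\<integral>\<^sup>+ \<omega>. emeasure (\<xi> \<omega>) A \<partial>P) + (\<integral>\<^sup>+ \<omega>. emeasure (\<xi> \<omega>) C \<partial>P)"
    using assms by (subst (asm) nn_integral_add) (auto simp: tame_def intro: \<xi>_measurable)
  then have "(\<integral>\<^sup>+ \<omega>. emeasure (\<xi> \<omega>) (A \<union> C) \<partial>P) < \<infinity>"
    using assms by (auto simp: tame_def intro: order_le_less_trans)
  ultimately show ?thesis
    using assms by (auto simp: tame_def)
qed

lemma tame_empty: "{} \<in> tame"
  by (simp add: tame_def)

lemma AE_finite: "A \<in> tame \<Longrightarrow> AE \<omega> in P. emeasure (\<xi> \<omega>) A < \<infinity>"
  using nn_integral_noteq_infinite[OF \<xi>_measurable, of A]
  by (auto simp: tame_def less_top)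

lemma measure_\<xi>_measurable:
  "A \<in> sets \<mu> \<Longrightarrow> (\<lambda>\<omega>. measure (\<xi> \<omega>) A) \<in> borel_measurable P"
  unfolding measure_def using \<xi>_measurable by measurable

lemma integrable_\<xi>:
  assumes "A \<in> tame"
  shows "integrable P (\<lambda>\<omega>. measure (\<xi> \<omega>) A)"
proof (rule integrableI_bounded)
  show "(\<lambda>\<omega>. measure (\<xi> \<omega>) A) \<in> borel_measurable P"
    using assms by (intro measure_\<xi>_measurable tame_sets)
  \<comment> \<open>Where \<open>emeasure\<close> is infinite, \<open>measure\<close> is 0, so the
    pointwise inequality holds there too.\<close>
  have "(\<integral>\<^sup>+ \<omega>. ennreal (norm (measure (\<xi> \<omega>) A)) \<partial>P) \<le> (\<integral>\<^sup>+ \<omega>. emeasure (\<xi> \<omega>) A \<partial>P)"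
    by (intro nn_integral_mono) (simp add: measure_def ennreal_enn2real_if)
  then show "(\<integral>\<^sup>+ \<omega>. ennreal (norm (measure (\<xi> \<omega>) A)) \<partial>P) < \<infinity>"
    using assms by (auto simp: tame_def intro: order_le_less_trans)
qed

lemma tame_cut:
  assumes "A \<in> tame" "0 \<le> s" "s \<le> measure \<mu> A"
  obtains A' where "A' \<in> tame" "A' \<subseteq> A" "measure \<mu> A' = s"
  using exists_cut[OF f_measurable f_inj f_range null_\<mu> tame_sets[OF assms(1)] tame_fin[OF assms(1)] assms(2,3)]
    tame_subset[OF assms(1)] by metis

lemma tame_swap:
  assumes "A \<in> tame" "A' \<in> tame" "B \<in> tame" "B' \<in> tame" "A \<inter> A' = {}" "B \<inter> B' = {}"
    "measure \<mu> A = measure \<mu> B" "measure \<mu> A' = measure \<mu> B'"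
  shows "(\<integral>\<omega>. \<bar>measure (\<xi> \<omega>) A - measure (\<xi> \<omega>) A'\<bar> \<partial>P) = (\<integral>\<omega>. \<bar>measure (\<xi> \<omega>) B - measure (\<xi> \<omega>) B'\<bar> \<partial>P)"
  using assms
  by (intro swap) (auto simp: tame_def less_top[symmetric] emeasure_eq_ennreal_measure)

lemma measure_Diff_tame:
  assumes "A \<in> tame" "C \<in> sets \<mu>" "C \<subseteq> A"
  shows "measure \<mu> (A - C) = measure \<mu> A - measure \<mu> C"
  using assms by (intro measure_Diff) (auto simp: tame_def)

lemma measure_\<xi>_Diff_tame:
  assumes "A \<in> tame" "C \<in> sets \<mu>" "C \<subseteq> A"
  shows "AE \<omega> in P. measure (\<xi> \<omega>) (A - C) = measure (\<xi> \<omega>) A - measure (\<xi> \<omega>) C"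
  using AE_finite[OF assms(1)] AE_space
proof eventually_elim
  case (elim \<omega>)
  then show ?case
    using assms by (intro measure_Diff) (auto simp: tame_def sets_\<xi>)
qed

section \<open>Cells along the injection \<open>f\<close>\<close>

text \<open>Intervals open on the left match the range \<open>{0<..1}\<close> of \<open>f\<close>,
  so that the first \<open>k\<close> cells partition \<open>B\<close> exactly when \<open>k\<close>
  is positive. For \<open>k = 0\<close>, division by zero makes both endpoints 0 and every cell
  empty.\<close>

definition cell :: "'a set \<Rightarrow> nat \<Rightarrow> nat \<Rightarrow> 'a set" where
  "cell B k i = B \<inter> f -` {real i / k<..real (Suc i) / k}"

lemma cell_sets:
  assumes "B \<in> sets \<mu>"
  shows "cell B k i \<in> sets \<mu>"
proof -
  have "cell B k i = B \<inter> (f -` {real i / k<..real (Suc i) / k} \<inter> space \<mu>)"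
    using sets.sets_into_space[OF assms] by (auto simp: cell_def)
  also have "\<dots> \<in> sets \<mu>"
    using assms f_measurable by (intro sets.Int measurable_sets) auto
  finally show ?thesis .
qed

lemma cell_unique:
  assumes "x \<in> cell B k i" "x \<in> cell C k j"
  shows "i = j"
proof (rule ccontr)
  have k: "k > 0" using assms by (cases k) (auto simp: cell_def)
  then have *: "real i < f x * k" "f x * k \<le> real (Suc i)" "real j < f x * k" "f x * k \<le> real (Suc j)"
    using assms by (auto simp: cell_def field_simps)
  assume "i \<noteq> j"
  then have "Suc i \<le> j \<or> Suc j \<le> i" by linarith
  then show False using * by auto
qed

lemma UN_cell:
  assumes "B \<in> sets \<mu>" "k > 0"
  shows "(\<Union>i<k. cell B k i) = B"
proof
  show "B \<subseteq> (\<Union>i<k. cell B k i)"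
  proof
    fix x assume x: "x \<in> B"
    then have "f x \<in> {0<..1}"
      using sets.sets_into_space[OF assms(1)] f_range by auto
    then have fx: "0 < f x * k" "f x * k \<le> k"
      using assms(2) by auto
    \<comment> \<open>Cells contain their right endpoint, so the index is the ceiling minus one, not
      the floor.\<close>
    define i where "i = nat (\<lceil>f x * k\<rceil> - 1)"
    have c: "\<lceil>f x * k\<rceil> \<ge> 1" "\<lceil>f x * k\<rceil> \<le> int k"
      using fx by (auto simp: ceiling_le_iff)
    then have "int i = \<lceil>f x * k\<rceil> - 1" unfolding i_def by simp
    then have ri: "real i = real_of_int \<lceil>f x * k\<rceil> - 1" by linarith
    then have "real i < f x * k" "f x * k \<le> real (Suc i)"
      by linarith+
    moreover have "i < k" using c unfolding i_def by linarith
    ultimately show "x \<in> (\<Union>i<k. cell B k i)"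
      using x assms(2) by (auto simp: cell_def field_simps intro!: bexI[of _ i])
  qed
qed (auto simp: cell_def)

text \<open>For almost every fixed \<open>\<omega>\<close> the trace of
  \<open>\<xi> \<omega>\<close> on \<open>B\<close> is a finite measure on the line, and diffuseness
  together with the injectivity of \<open>f\<close> excludes point masses.\<close>

lemma sum_cells_squared_tendsto_0:
  assumes "B \<in> tame"
  shows "AE \<omega> in P. (\<lambda>k. \<Sum>i<k. (measure (\<xi> \<omega>) (cell B k i))\<^sup>2) \<longlonglongrightarrow> 0"
  using AE_finite[OF assms] diffuse_\<xi> AE_space
proof eventually_elim
  case (elim \<omega>)
  have f: "f \<in> borel_measurable (\<xi> \<omega>)"
    using f_measurable elim(3) by (simp add: measurable_def space_\<xi> sets_\<xi>)
  have B: "B \<in> sets (\<xi> \<omega>)"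
    using assms elim by (simp add: tame_sets sets_\<xi>)
  have "measure (trace_distr (\<xi> \<omega>) B f) {x} = 0" for x
    using elim f_inj f B by (intro measure_trace_distr_singleton) (auto simp: space_\<xi> diffuse_def)
  then have "(\<lambda>k. \<Sum>i<k. (measure (trace_distr (\<xi> \<omega>) B f) {real i / k<..real (Suc i) / k})\<^sup>2) \<longlonglongrightarrow> 0"
    using f B elim
    by (intro sum_measure_cells_squared_tendsto_0 finite_borel_measure_trace_distr) auto
  then show ?case
    using f B by (simp add: measure_trace_distr cell_def)
qed

section \<open>Sets of equal mass under \<open>\<mu>\<close>\<close>

text \<open>Each choice \<open>J\<close> of signs recombines the half-cells into two disjoint sets
  \<open>C J\<close> and \<open>C (- J)\<close>, both with half the \<open>\<mu>\<close>-mass of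
  \<open>B\<close>, which is the mass of \<open>A1\<close>. All these pairs share the expected
  absolute difference of \<open>A1\<close> and \<open>A2\<close>, which therefore equals its average
  over \<open>J\<close>; the bound for signed sums applies to that average pointwise.\<close>

lemma integral_abs_diff_le_cells:
  assumes A: "A1 \<in> tame" "A2 \<in> tame" "A1 \<inter> A2 = {}" "measure \<mu> A1 = measure \<mu> A2" and k: "k > 0"
  shows "(\<integral>\<omega>. \<bar>measure (\<xi> \<omega>) A1 - measure (\<xi> \<omega>) A2\<bar> \<partial>P)
    \<le> (\<integral>\<omega>. sqrt (\<Sum>i<k. (measure (\<xi> \<omega>) (cell (A1 \<union> A2) k i))\<^sup>2) \<partial>P)"
proof -
  define B where "B = A1 \<union> A2"
  have B: "B \<in> tame" unfolding B_def using A by (intro tame_Un)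
  have cell_tame: "cell B k i \<in> tame" for i
    using B cell_sets[OF tame_sets[OF B]] by (rule tame_subset) (auto simp: cell_def)
  have "\<forall>i. \<exists>L. L \<in> tame \<and> L \<subseteq> cell B k i \<and> measure \<mu> L = measure \<mu> (cell B k i) / 2"
    using tame_cut[OF cell_tame, of "measure \<mu> (cell B k i) / 2" i for i] by (metis field_sum_of_halves
      half_gt_zero_iff le_add_same_cancel1 less_eq_real_def measure_nonneg zero_le_divide_iff zero_le_numeral)
  then obtain L where L: "\<And>i. L i \<in> tame" "\<And>i. L i \<subseteq> cell B k i"
      "\<And>i. measure \<mu> (L i) = measure \<mu> (cell B k i) / 2"
    by metis
  define R where "R i = cell B k i - L i" for i
  have R: "R i \<in> tame" "R i \<subseteq> cell B k i" "L i \<inter> R i = {}" "L i \<union> R i = cell B k i" for i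
    using L cell_tame[of i] tame_sets[OF L(1)[of i]] tame_sets[OF cell_tame[of i]]
    by (auto simp: R_def intro!: tame_subset[OF cell_tame[of i]])
  have \<mu>R: "measure \<mu> (R i) = measure \<mu> (cell B k i) / 2" for i
    unfolding R_def using L[of i] cell_tame[of i] by (simp add: measure_Diff_tame tame_sets)
  define piece where "piece J i = (if i \<in> J then L i else R i)" for J i
  define C where "C J = (\<Union>i<k. piece J i)" for J
  have piece: "piece J i \<in> tame" "piece J i \<subseteq> cell B k i" for J i
    using L R by (auto simp: piece_def)
  have disj: "disjoint_family_on (piece J) {..<k}" for J
    using piece(2) cell_unique unfolding disjoint_family_on_def by blast
  have C_tame: "C J \<in> tame" for J
  proof (rule tame_subset[OF B])
    show "C J \<in> sets \<mu>" unfolding C_def using piece by (auto intro: tame_sets)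
    show "C J \<subseteq> B" unfolding C_def using piece(2) by (auto simp: cell_def)
  qed
  have \<mu>C: "measure \<mu> (C J) = measure \<mu> A1" for J
  proof -
    have "measure \<mu> (C J) = (\<Sum>i<k. measure \<mu> (piece J i))"
      unfolding C_def using piece disj tame_fin[OF piece(1)]
      by (intro measure_finite_Union) (auto simp: tame_sets less_top[symmetric])
    also have "\<dots> = (\<Sum>i<k. measure \<mu> (cell B k i)) / 2"
      unfolding sum_divide_distrib using L \<mu>R by (intro sum.cong) (auto simp: piece_def)
    also have "(\<Sum>i<k. measure \<mu> (cell B k i)) = measure \<mu> (\<Union>i<k. cell B k i)"
      using cell_tame tame_fin[OF cell_tame] cell_unique
      by (intro measure_finite_Union[symmetric]) (auto simp: tame_sets disjoint_family_on_def less_top[symmetric])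
    also have "(\<Union>i<k. cell B k i) = B"
      using B k by (intro UN_cell tame_sets)
    also have "measure \<mu> B = measure \<mu> A1 + measure \<mu> A2"
      unfolding B_def using A tame_fin[of A1] tame_fin[of A2]
      by (intro measure_Union) (auto simp: tame_sets)
    finally show ?thesis using A by simp
  qed
  \<comment> \<open>The complement is taken in all natural numbers, but only indices below
    \<open>k\<close> enter: passing to \<open>- J\<close> exchanges the two halves of every
    cell.\<close>
  have C_disj: "C J \<inter> C (- J) = {}" for J
  proof -
    have "piece J i \<inter> piece (- J) j = {}" for i j
    proof (cases "i = j")
      case True
      then show ?thesis using R(3)[of i] by (auto simp: piece_def)
    next
      case False
      then show ?thesis using piece(2) cell_unique by blast
    qed
    then show ?thesis unfolding C_def by blast
  qed
  define d where "d \<omega> i = measure (\<xi> \<omega>) (L i) - measure (\<xi> \<omega>) (R i)" for \<omega> i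
  \<comment> \<open>The exceptional event, that \<open>B\<close> has infinite mass, does not depend
    on \<open>J\<close>; hence the quantifier over \<open>J\<close> stands inside.\<close>
  have \<xi>C: "AE \<omega> in P. \<forall>J. measure (\<xi> \<omega>) (C J) = (\<Sum>i<k. measure (\<xi> \<omega>) (piece J i))"
    using AE_finite[OF B] AE_space
  proof eventually_elim
    case (elim \<omega>)
    have "emeasure (\<xi> \<omega>) (piece J i) \<noteq> \<infinity>" for J i
    proof -
      have "emeasure (\<xi> \<omega>) (piece J i) \<le> emeasure (\<xi> \<omega>) B"
        using piece(2) elim B by (intro emeasure_mono) (auto simp: cell_def sets_\<xi> tame_sets)
      then show ?thesis using elim by auto
    qed
    then show ?case
      unfolding C_def using piece disj elim
      by (intro allI measure_finite_Union) (auto simp: tame_sets sets_\<xi>)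
  qed
  then have diff: "AE \<omega> in P. \<forall>J. measure (\<xi> \<omega>) (C J) - measure (\<xi> \<omega>) (C (- J))
      = (\<Sum>i<k. if i \<in> J then d \<omega> i else - d \<omega> i)"
  proof eventually_elim
    case (elim \<omega>)
    show ?case
      using elim by (auto simp: sum_subtractf[symmetric] piece_def d_def intro!: sum.cong)
  qed
  let ?I = "\<integral>\<omega>. \<bar>measure (\<xi> \<omega>) A1 - measure (\<xi> \<omega>) A2\<bar> \<partial>P"
  let ?D = "\<lambda>J \<omega>. \<bar>measure (\<xi> \<omega>) (C J) - measure (\<xi> \<omega>) (C (- J))\<bar>"
  have int_D: "integrable P (?D J)" for J
    using C_tame by (intro integrable_abs Bochner_Integration.integrable_diff integrable_\<xi>)
  have "?I = (\<integral>\<omega>. ?D J \<omega> \<partial>P)" for J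
    using A C_tame C_disj by (intro tame_swap) (auto simp: \<mu>C)
  \<comment> \<open>The summand is constant, so the left side is \<open>2 ^ k * ?I\<close>; this
    factor cancels against the one in the bound for signed sums.\<close>
  then have "(\<Sum>J\<in>Pow {..<k}. ?I) = (\<Sum>J\<in>Pow {..<k}. \<integral>\<omega>. ?D J \<omega> \<partial>P)"
    by simp
  also have "\<dots> = (\<integral>\<omega>. (\<Sum>J\<in>Pow {..<k}. ?D J \<omega>) \<partial>P)"
    using int_D by (intro Bochner_Integration.integral_sum[symmetric])
  also have "\<dots> \<le> (\<integral>\<omega>. 2 ^ k * sqrt (\<Sum>i<k. (measure (\<xi> \<omega>) (cell B k i))\<^sup>2) \<partial>P)"
  proof (rule integral_mono_AE)
    show "integrable P (\<lambda>\<omega>. \<Sum>J\<in>Pow {..<k}. ?D J \<omega>)"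
      using int_D by (intro Bochner_Integration.integrable_sum)
    have "integrable P (\<lambda>\<omega>. sqrt (\<Sum>i<k. (measure (\<xi> \<omega>) (cell B k i))\<^sup>2))"
    proof (rule Bochner_Integration.integrable_bound)
      show "integrable P (\<lambda>\<omega>. \<Sum>i<k. measure (\<xi> \<omega>) (cell B k i))"
        using cell_tame by (intro Bochner_Integration.integrable_sum integrable_\<xi>)
      show "(\<lambda>\<omega>. sqrt (\<Sum>i<k. (measure (\<xi> \<omega>) (cell B k i))\<^sup>2)) \<in> borel_measurable P"
        using measure_\<xi>_measurable[OF tame_sets[OF cell_tame]] by measurable
      \<comment> \<open>The l2-norm is at most the l1-norm, which is integrable.\<close>
      show "AE \<omega> in P. norm (sqrt (\<Sum>i<k. (measure (\<xi> \<omega>) (cell B k i))\<^sup>2))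
          \<le> norm (\<Sum>i<k. measure (\<xi> \<omega>) (cell B k i))"
        using L2_set_le_sum[of "{..<k}" "\<lambda>i. measure (\<xi> \<omega>) (cell B k i)" for \<omega>]
        by (intro AE_I2) (auto simp: L2_set_def sum_nonneg)
    qed
    then show "integrable P (\<lambda>\<omega>. 2 ^ k * sqrt (\<Sum>i<k. (measure (\<xi> \<omega>) (cell B k i))\<^sup>2))"
      by simp
    show "AE \<omega> in P. (\<Sum>J\<in>Pow {..<k}. ?D J \<omega>)
        \<le> 2 ^ k * sqrt (\<Sum>i<k. (measure (\<xi> \<omega>) (cell B k i))\<^sup>2)"
      using diff AE_finite[OF B] AE_space
    proof eventually_elim
      case (elim \<omega>)
      \<comment> \<open>Both halves have mass between 0 and that of the cell, so the bound no longer
        depends on how the cell was halved.\<close>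
      have "\<bar>d \<omega> i\<bar> \<le> measure (\<xi> \<omega>) (cell B k i)" for i
      proof -
        have "emeasure (\<xi> \<omega>) (cell B k i) \<le> emeasure (\<xi> \<omega>) B"
          using elim B by (intro emeasure_mono) (auto simp: cell_def sets_\<xi> tame_sets)
        then have fin: "emeasure (\<xi> \<omega>) (cell B k i) < \<infinity>" using elim by auto
        have fm: "cell B k i \<in> fmeasurable (\<xi> \<omega>)"
          using fin elim cell_tame by (intro fmeasurableI) (auto simp: sets_\<xi> tame_sets)
        have "measure (\<xi> \<omega>) (L i) \<le> measure (\<xi> \<omega>) (cell B k i)"
          "measure (\<xi> \<omega>) (R i) \<le> measure (\<xi> \<omega>) (cell B k i)"
          using L R(1,2) fm elim
          by (intro measure_mono_fmeasurable; simp add: sets_\<xi> tame_sets)+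
        then show ?thesis
          unfolding d_def using measure_nonneg[of "\<xi> \<omega>" "L i"] measure_nonneg[of "\<xi> \<omega>" "R i"]
          by linarith
      qed
      then have "(\<Sum>i<k. (d \<omega> i)\<^sup>2) \<le> (\<Sum>i<k. (measure (\<xi> \<omega>) (cell B k i))\<^sup>2)"
        by (intro sum_mono) (simp add: abs_le_square_iff[symmetric])
      moreover have "(\<Sum>J\<in>Pow {..<k}. ?D J \<omega>) \<le> 2 ^ k * sqrt (\<Sum>i<k. (d \<omega> i)\<^sup>2)"
        using sum_Pow_abs_signed_sum_le[of "{..<k}" "d \<omega>"] elim(1) by simp
      ultimately show ?case
        by (auto elim!: order_trans)
    qed
  qed
  finally show ?thesis
    by (simp add: card_Pow B_def)
qed

text \<open>Supplies the majorant for dominated convergence, since the l2-norm of the cell masses is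
  at most their sum. The inequality also covers \<open>k = 0\<close>, where the sum is
  empty.\<close>

lemma AE_sum_cells_le:
  assumes B: "B \<in> tame"
  shows "AE \<omega> in P. \<forall>k. (\<Sum>i<k. measure (\<xi> \<omega>) (cell B k i)) \<le> measure (\<xi> \<omega>) B"
  using AE_finite[OF B] AE_space
proof eventually_elim
  case (elim \<omega>)
  have fB: "B \<in> fmeasurable (\<xi> \<omega>)"
    using elim B by (intro fmeasurableI) (auto simp: sets_\<xi> tame_sets)
  have sub: "cell B k i \<subseteq> B" for k i by (auto simp: cell_def)
  have cell: "cell B k i \<in> sets (\<xi> \<omega>)" for k i
    using elim cell_sets[OF tame_sets[OF B]] by (simp add: sets_\<xi>)
  have fin: "emeasure (\<xi> \<omega>) (cell B k i) \<noteq> \<infinity>" for k i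
    using emeasure_mono[OF sub[of k i], of "\<xi> \<omega>"] fB by (auto simp: fmeasurable_def)
  show ?case
  proof
    fix k
    have "disjoint_family_on (cell B k) {..<k}"
      using cell_unique unfolding disjoint_family_on_def by blast
    then have "(\<Sum>i<k. measure (\<xi> \<omega>) (cell B k i)) = measure (\<xi> \<omega>) (\<Union>i<k. cell B k i)"
      using fin cell by (intro measure_finite_Union[symmetric]) auto
    also have "\<dots> \<le> measure (\<xi> \<omega>) B"
      using sub cell fB by (intro measure_mono_fmeasurable) auto
    finally show "(\<Sum>i<k. measure (\<xi> \<omega>) (cell B k i)) \<le> measure (\<xi> \<omega>) B" .
  qed
qed

text \<open>The expected absolute difference is bounded, for every positive \<open>k\<close>, by the
  expected l2-norm of the cell masses. With \<open>\<xi> ?B\<close> as majorant these expectations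
  tend to 0, so a nonnegative variable has expectation 0.\<close>

lemma AE_eq_if_disjoint:
  assumes A: "A1 \<in> tame" "A2 \<in> tame" "A1 \<inter> A2 = {}" "measure \<mu> A1 = measure \<mu> A2"
  shows "AE \<omega> in P. measure (\<xi> \<omega>) A1 = measure (\<xi> \<omega>) A2"
proof -
  let ?B = "A1 \<union> A2"
  let ?I = "\<integral>\<omega>. \<bar>measure (\<xi> \<omega>) A1 - measure (\<xi> \<omega>) A2\<bar> \<partial>P"
  let ?s = "\<lambda>k \<omega>. sqrt (\<Sum>i<k. (measure (\<xi> \<omega>) (cell ?B k i))\<^sup>2)"
  have B: "?B \<in> tame" using A by (intro tame_Un)
  have "(\<lambda>k. \<integral>\<omega>. ?s k \<omega> \<partial>P) \<longlonglongrightarrow> (\<integral>\<omega>. 0 \<partial>P)"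
  proof (rule integral_dominated_convergence[where w = "\<lambda>\<omega>. measure (\<xi> \<omega>) ?B"])
    show "integrable P (\<lambda>\<omega>. measure (\<xi> \<omega>) ?B)"
      using B by (rule integrable_\<xi>)
    show "?s k \<in> borel_measurable P" for k
      using measure_\<xi>_measurable[OF cell_sets[OF tame_sets[OF B]]] by measurable
    show "AE \<omega> in P. (\<lambda>k. ?s k \<omega>) \<longlonglongrightarrow> 0"
      using sum_cells_squared_tendsto_0[OF B]
    proof eventually_elim
      case (elim \<omega>)
      show ?case using tendsto_real_sqrt[OF elim] by simp
    qed
    show "AE \<omega> in P. norm (?s k \<omega>) \<le> measure (\<xi> \<omega>) ?B" for k
      using AE_sum_cells_le[OF B]
    proof eventually_elim
      case (elim \<omega>)
      have "?s k \<omega> \<le> (\<Sum>i<k. measure (\<xi> \<omega>) (cell ?B k i))"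
        using L2_set_le_sum[of "{..<k}" "\<lambda>i. measure (\<xi> \<omega>) (cell ?B k i)"]
        by (simp add: L2_set_def)
      also have "\<dots> \<le> measure (\<xi> \<omega>) ?B" using elim by blast
      finally show ?case by (simp add: sum_nonneg)
    qed
  qed simp
  then have "(\<lambda>k. \<integral>\<omega>. ?s k \<omega> \<partial>P) \<longlonglongrightarrow> 0" by simp
  moreover have "\<forall>\<^sub>F k in sequentially. ?I \<le> (\<integral>\<omega>. ?s k \<omega> \<partial>P)"
    using eventually_gt_at_top[of "0::nat"] integral_abs_diff_le_cells[OF A]
    by (rule eventually_mono)
  ultimately have "?I \<le> 0"
    by (rule tendsto_lowerbound) simp
  moreover have "?I \<ge> 0" by simp
  ultimately have "?I = 0" by linarith
  then have "AE \<omega> in P. \<bar>measure (\<xi> \<omega>) A1 - measure (\<xi> \<omega>) A2\<bar> = 0"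
    using A by (subst (asm) integral_nonneg_eq_0_iff_AE) (auto intro!: integrable_\<xi>)
  then show ?thesis by eventually_elim simp
qed

text \<open>Removing the common part leaves disjoint sets that still have equal
  \<open>\<mu>\<close>-mass.\<close>

lemma AE_eq:
  assumes A: "A1 \<in> tame" "A2 \<in> tame" "measure \<mu> A1 = measure \<mu> A2"
  shows "AE \<omega> in P. measure (\<xi> \<omega>) A1 = measure (\<xi> \<omega>) A2"
proof -
  let ?C = "A1 \<inter> A2"
  have C: "?C \<in> sets \<mu>" using A by (auto intro: tame_sets)
  have t: "A1 - ?C \<in> tame" "A2 - ?C \<in> tame"
    using tame_subset[OF A(1) sets.Diff[OF tame_sets[OF A(1)] C]]
      tame_subset[OF A(2) sets.Diff[OF tame_sets[OF A(2)] C]] by auto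
  have "measure \<mu> (A1 - ?C) = measure \<mu> (A2 - ?C)"
    using A C by (simp add: measure_Diff_tame)
  with t have "AE \<omega> in P. measure (\<xi> \<omega>) (A1 - ?C) = measure (\<xi> \<omega>) (A2 - ?C)"
    by (intro AE_eq_if_disjoint) auto
  with measure_\<xi>_Diff_tame[OF A(1) C Int_lower1] measure_\<xi>_Diff_tame[OF A(2) C Int_lower2]
  show ?thesis by eventually_elim simp
qed

section \<open>Linearity in the mass under \<open>\<mu>\<close>\<close>

text \<open>Pieces with the \<open>\<mu>\<close>-mass of \<open>C\<close> are peeled off
  \<open>A\<close> one at a time, and each almost surely has the \<open>\<xi>\<close>-mass of
  \<open>C\<close>. The remainder changes along the induction, so \<open>A\<close> is
  arbitrary.\<close>

lemma AE_multiple: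
  assumes "A \<in> tame" "C \<in> tame" "measure \<mu> A = real k * measure \<mu> C"
  shows "AE \<omega> in P. measure (\<xi> \<omega>) A = real k * measure (\<xi> \<omega>) C"
  using assms(1,3)
proof (induction k arbitrary: A)
  case 0
  then show ?case using AE_eq[OF _ tame_empty, of A] by simp
next
  case (Suc k)
  have "measure \<mu> C \<le> measure \<mu> A"
    using Suc.prems by (simp add: algebra_simps)
  then obtain A' where A': "A' \<in> tame" "A' \<subseteq> A" "measure \<mu> A' = measure \<mu> C"
    using tame_cut[OF Suc.prems(1) measure_nonneg] by metis
  have "A - A' \<in> tame"
    using tame_subset[OF Suc.prems(1) sets.Diff[OF tame_sets[OF Suc.prems(1)] tame_sets[OF A'(1)]]]
    by blast
  moreover have "measure \<mu> (A - A') = real k * measure \<mu> C"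
    unfolding measure_Diff_tame[OF Suc.prems(1) tame_sets[OF A'(1)] A'(2)] A'(3) Suc.prems(2)
    by (simp add: algebra_simps)
  ultimately have "AE \<omega> in P. measure (\<xi> \<omega>) (A - A') = real k * measure (\<xi> \<omega>) C"
    by (rule Suc.IH)
  with measure_\<xi>_Diff_tame[OF Suc.prems(1) tame_sets[OF A'(1)] A'(2)] AE_eq[OF A'(1) assms(2) A'(3)]
  show ?case by eventually_elim (simp add: algebra_simps)
qed

text \<open>A piece with the \<open>\<mu>\<close>-mass of \<open>A\<close> is cut out of
  \<open>C\<close>; what remains of \<open>C\<close> has nonnegative mass.\<close>

lemma AE_le:
  assumes A: "A \<in> tame" "C \<in> tame" "measure \<mu> A \<le> measure \<mu> C"
  shows "AE \<omega> in P. measure (\<xi> \<omega>) A \<le> measure (\<xi> \<omega>) C"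
proof -
  obtain C' where C': "C' \<in> tame" "C' \<subseteq> C" "measure \<mu> C' = measure \<mu> A"
    using tame_cut[OF A(2) measure_nonneg A(3)] by metis
  have "AE \<omega> in P. measure (\<xi> \<omega>) C - measure (\<xi> \<omega>) C' \<ge> 0"
    using measure_\<xi>_Diff_tame[OF A(2) tame_sets[OF C'(1)] C'(2)]
    by eventually_elim (metis measure_nonneg)
  with AE_eq[OF A(1) C'(1) C'(3)[symmetric]] show ?thesis
    by eventually_elim simp
qed

text \<open>Take an \<open>n\<close>-th part \<open>C\<close> of \<open>B\<close> as unit. Almost
  surely both \<open>\<xi> A\<close> and \<open>q\<close> times \<open>\<xi> B\<close> lie between
  \<open>k\<close> and \<open>k + 1\<close> units, so they differ by at most
  \<open>\<xi> B / n\<close>, which vanishes as \<open>n\<close> grows.\<close>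

lemma AE_proportional:
  assumes A: "A \<in> tame" and B: "B \<in> tame" "measure \<mu> B > 0"
  shows "AE \<omega> in P. measure (\<xi> \<omega>) A = measure \<mu> A / measure \<mu> B * measure (\<xi> \<omega>) B"
proof -
  define q where "q = measure \<mu> A / measure \<mu> B"
  have q: "q \<ge> 0" unfolding q_def by simp
  have approx: "AE \<omega> in P. \<bar>measure (\<xi> \<omega>) A - q * measure (\<xi> \<omega>) B\<bar> \<le> measure (\<xi> \<omega>) B / n"
    if n: "n > 0" for n :: nat
  proof -
    \<comment> \<open>The set \<open>A\<close> measures \<open>q * n\<close> units under
      \<open>\<mu>\<close>, so \<open>k\<close> is the number of whole units that fit into
      it.\<close>
    define k where "k = nat \<lfloor>q * n\<rfloor>"
    have k: "real k \<le> q * n" "q * n \<le> real k + 1"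
      using q n unfolding k_def by auto
    have "0 \<le> measure \<mu> B / n" "measure \<mu> B / n \<le> measure \<mu> B"
      using n B by (simp_all add: divide_le_eq)
    then obtain C where C: "C \<in> tame" "C \<subseteq> B" "measure \<mu> C = measure \<mu> B / n"
      by (rule tame_cut[OF B(1)]) (rule that)
    have \<mu>A: "measure \<mu> A = q * n * measure \<mu> C"
      using B n C(3) by (simp add: q_def)
    have kA: "real k * measure \<mu> C \<le> measure \<mu> A"
      unfolding \<mu>A using k(1) measure_nonneg by (rule mult_right_mono)
    have "0 \<le> real k * measure \<mu> C" by simp
    then obtain A' where A': "A' \<in> tame" "A' \<subseteq> A" "measure \<mu> A' = real k * measure \<mu> C"
      using kA by (rule tame_cut[OF A]) (rule that)
    have "A - A' \<in> tame"
      using tame_subset[OF A sets.Diff[OF tame_sets[OF A] tame_sets[OF A'(1)]]] by blast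
    moreover have "measure \<mu> (A - A') \<le> measure \<mu> C"
    proof -
      have "measure \<mu> A \<le> (real k + 1) * measure \<mu> C"
        unfolding \<mu>A using k(2) measure_nonneg by (rule mult_right_mono)
      then show ?thesis
        unfolding measure_Diff_tame[OF A tame_sets[OF A'(1)] A'(2)] A'(3) by (simp add: distrib_right)
    qed
    ultimately have "AE \<omega> in P. measure (\<xi> \<omega>) (A - A') \<le> measure (\<xi> \<omega>) C"
      using C(1) by (intro AE_le)
    moreover have "AE \<omega> in P. measure (\<xi> \<omega>) B = real n * measure (\<xi> \<omega>) C"
      using n C(3) by (intro AE_multiple[OF B(1) C(1)]) simp
    moreover have "AE \<omega> in P. measure (\<xi> \<omega>) A' = real k * measure (\<xi> \<omega>) C"
      using A'(1) C(1) A'(3) by (rule AE_multiple)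
    ultimately show ?thesis
      using measure_\<xi>_Diff_tame[OF A tame_sets[OF A'(1)] A'(2)]
    proof eventually_elim
      case (elim \<omega>)
      define c where "c = measure (\<xi> \<omega>) C"
      have c: "c \<ge> 0" "measure (\<xi> \<omega>) B / n = c"
        using elim n by (auto simp: c_def)
      have lo: "real k * c \<le> measure (\<xi> \<omega>) A"
        using elim measure_nonneg[of "\<xi> \<omega>" "A - A'"] by (simp add: c_def)
      have hi: "measure (\<xi> \<omega>) A \<le> real k * c + c"
        using elim by (simp add: c_def)
      have "real k * c \<le> q * n * c" "q * n * c \<le> (real k + 1) * c"
        using k c(1) by (simp_all only: mult_right_mono)
      moreover have "q * measure (\<xi> \<omega>) B = q * n * c"
        using elim by (simp add: c_def)
      ultimately show ?case
        using lo hi unfolding c(2) abs_le_iff distrib_right mult_1 by linarith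
    qed
  qed
  \<comment> \<open>Only countably many \<open>n\<close> occur, so one null event permits the limit
    at fixed \<open>\<omega>\<close>.\<close>
  have "AE \<omega> in P. \<forall>n::nat. n > 0 \<longrightarrow> \<bar>measure (\<xi> \<omega>) A - q * measure (\<xi> \<omega>) B\<bar> \<le> measure (\<xi> \<omega>) B / n"
    using approx by (simp add: AE_all_countable)
  then show ?thesis
  proof eventually_elim
    case (elim \<omega>)
    have "(\<lambda>n. measure (\<xi> \<omega>) B / real n) \<longlonglongrightarrow> 0"
      by (rule lim_const_over_n)
    then have "\<bar>measure (\<xi> \<omega>) A - q * measure (\<xi> \<omega>) B\<bar> \<le> 0"
    proof (rule tendsto_lowerbound)
      show "\<forall>\<^sub>F n in sequentially. \<bar>measure (\<xi> \<omega>) A - q * measure (\<xi> \<omega>) B\<bar> \<le> measure (\<xi> \<omega>) B / real n"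
        using eventually_gt_at_top[of "0::nat"] by (rule eventually_mono) (simp add: elim)
    qed simp
    then show ?case by (simp add: q_def)
  qed
qed

text \<open>Any tame \<open>B\<close> of positive \<open>\<mu>\<close>-mass serves as reference,
  with factor \<open>\<xi> B / \<mu> B\<close>. If there is none, every tame set is compared with
  the empty set and the factor is 0. The null event may still depend on \<open>A\<close>.\<close>

lemma exists_factor:
  "\<exists>\<alpha>. integrable P \<alpha> \<and> (\<forall>\<omega>\<in>space P. 0 \<le> \<alpha> \<omega>) \<and>
    (\<forall>A\<in>tame. AE \<omega> in P. measure (\<xi> \<omega>) A = \<alpha> \<omega> * measure \<mu> A)"
proof (cases "\<exists>B\<in>tame. measure \<mu> B > 0")
  case True
  then obtain B where B: "B \<in> tame" "measure \<mu> B > 0" by blast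
  show ?thesis
  proof (intro exI[of _ "\<lambda>\<omega>. measure (\<xi> \<omega>) B / measure \<mu> B"] conjI ballI)
    show "integrable P (\<lambda>\<omega>. measure (\<xi> \<omega>) B / measure \<mu> B)"
      using B by (intro integrable_divide integrable_\<xi>)
    show "AE \<omega> in P. measure (\<xi> \<omega>) A = measure (\<xi> \<omega>) B / measure \<mu> B * measure \<mu> A" if "A \<in> tame" for A
      using AE_proportional[OF that B] by (simp add: mult.commute)
  qed simp
next
  case False
  then have "measure \<mu> A = 0" if "A \<in> tame" for A
    using that measure_nonneg[of \<mu> A] by (metis less_eq_real_def)
  then have "AE \<omega> in P. measure (\<xi> \<omega>) A = 0" if "A \<in> tame" for A
    using AE_eq[OF that tame_empty] that by simp
  then show ?thesis
    by (intro exI[of _ "\<lambda>_. 0"]) simp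
qed

section \<open>One null event for all measurable sets\<close>

text \<open>This is deterministic, for one fixed \<open>\<omega>\<close>. The traces on
  \<open>M\<close> of \<open>\<xi> \<omega>\<close> and of \<open>\<mu>\<close> scaled by
  \<open>c\<close> have continuous distribution functions that agree on the rationals, hence
  everywhere. So the traces coincide, and \<open>f_generates\<close> carries this back to
  \<open>A\<close>.\<close>

lemma emeasure_eq_scale_if_rational_cuts:
  assumes \<omega>: "\<omega> \<in> space P" and diffuse: "diffuse (\<xi> \<omega>)" and c: "0 \<le> c"
    and M: "M \<in> tame" and fin: "emeasure (\<xi> \<omega>) M < \<infinity>"
    and cuts: "\<And>q. q \<in> \<rat> \<Longrightarrow> measure (\<xi> \<omega>) (M \<inter> f -` {..q}) = c * measure \<mu> (M \<inter> f -` {..q})"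
    and A: "A \<in> sets \<mu>"
  shows "emeasure (\<xi> \<omega>) (A \<inter> M) = ennreal c * emeasure \<mu> (A \<inter> M)"
proof -
  let ?N = "trace_distr (\<xi> \<omega>) M f"
  let ?M = "scale_measure (ennreal c) \<mu>"
  let ?L = "trace_distr ?M M f"
  have f: "f \<in> borel_measurable (\<xi> \<omega>)" "f \<in> borel_measurable ?M"
    using f_measurable \<omega> by (auto simp: measurable_def space_\<xi> sets_\<xi> space_scale_measure)
  have MS: "M \<in> sets (\<xi> \<omega>)" "M \<in> sets ?M"
    using M \<omega> by (auto simp: tame_sets sets_\<xi>)
  have finM: "emeasure ?M M < \<infinity>"
    using M tame_fin[OF M] by (auto simp: ennreal_mult_less_top)
  interpret N: finite_borel_measure ?N
    using f MS fin by (intro finite_borel_measure_trace_distr)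
  interpret L: finite_borel_measure ?L
    using f MS finM by (intro finite_borel_measure_trace_distr)
  have "isCont (cdf ?N) x" for x
    unfolding N.isCont_cdf using f MS f_inj diffuse \<omega>
    by (intro measure_trace_distr_singleton) (auto simp: space_\<xi> diffuse_def)
  moreover have "isCont (cdf ?L) x" for x
    unfolding L.isCont_cdf using f MS f_inj null_\<mu>
    by (intro measure_trace_distr_singleton) (auto simp: space_scale_measure)
  ultimately have cont: "continuous_on UNIV (\<lambda>x. cdf ?N x - cdf ?L x)"
    by (intro continuous_at_imp_continuous_on ballI continuous_diff)
  have "cdf ?N q - cdf ?L q = 0" if "q \<in> \<rat>" for q
    using cuts[OF that] f MS c by (simp add: cdf_def measure_trace_distr)
  then have "cdf ?N x - cdf ?L x = 0" for x
    using continuous_constant_on_closure[of "\<rat>" "\<lambda>x. cdf ?N x - cdf ?L x" 0 x] cont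
    by (simp add: Rats_closure_real)
  then have "cdf ?N = cdf ?L"
    by (intro ext) (simp add: algebra_simps)
  then have "?N = ?L"
    using N.finite_borel_measure_axioms L.finite_borel_measure_axioms by (intro cdf_unique')
  moreover obtain C where C: "C \<in> sets borel" "A = f -` C \<inter> space \<mu>"
    using f_generates[OF A] by blast
  moreover have "A \<inter> M = M \<inter> f -` C"
    using C(2) sets.sets_into_space[OF tame_sets[OF M]] by auto
  ultimately show ?thesis
    using emeasure_trace_distr[OF f(1) MS(1) C(1)] emeasure_trace_distr[OF f(2) MS(2) C(1)] by simp
qed

text \<open>Cutting each \<open>M n\<close> at rational levels gives countably many test sets, hence
  one null event. Outside it \<open>emeasure_eq_scale_if_rational_cuts\<close> reaches every
  measurable subset of each \<open>M n\<close>.\<close>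

lemma exists_random_multiple:
  fixes M :: "nat \<Rightarrow> 'a set"
  assumes M: "range M \<subseteq> tame" "disjoint_family M" "(\<Union>n. M n) = space \<mu>"
  shows "\<exists>\<alpha>. integrable P \<alpha> \<and> (\<forall>\<omega>\<in>space P. 0 \<le> \<alpha> \<omega>) \<and>
    (AE \<omega> in P. \<forall>A\<in>sets \<mu>. emeasure (\<xi> \<omega>) A = ennreal (\<alpha> \<omega>) * emeasure \<mu> A)"
proof -
  obtain \<alpha> where \<alpha>: "integrable P \<alpha>" "\<And>\<omega>. \<omega> \<in> space P \<Longrightarrow> 0 \<le> \<alpha> \<omega>"
    "\<And>A. A \<in> tame \<Longrightarrow> AE \<omega> in P. measure (\<xi> \<omega>) A = \<alpha> \<omega> * measure \<mu> A"
    using exists_factor by auto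
  have Mn: "M n \<in> tame" for n using M by auto
  have cut: "M n \<inter> f -` {..q} \<in> tame" for n q
  proof (rule tame_subset[OF Mn])
    have "M n \<inter> f -` {..q} = M n \<inter> (f -` {..q} \<inter> space \<mu>)"
      using sets.sets_into_space[OF tame_sets[OF Mn[of n]]] by auto
    also have "\<dots> \<in> sets \<mu>"
      using f_measurable tame_sets[OF Mn] by (intro sets.Int measurable_sets) auto
    finally show "M n \<inter> f -` {..q} \<in> sets \<mu>" .
    show "M n \<inter> f -` {..q} \<subseteq> M n" by simp
  qed
  have "AE \<omega> in P. \<forall>n. \<forall>q\<in>\<rat>.
      measure (\<xi> \<omega>) (M n \<inter> f -` {..q}) = \<alpha> \<omega> * measure \<mu> (M n \<inter> f -` {..q})"
    using \<alpha>(3)[OF cut] by (simp add: AE_all_countable AE_ball_countable countable_rat)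
  moreover have "AE \<omega> in P. \<forall>n. emeasure (\<xi> \<omega>) (M n) < \<infinity>"
    using AE_finite[OF Mn] by (simp add: AE_all_countable)
  ultimately have "AE \<omega> in P. \<forall>A\<in>sets \<mu>. emeasure (\<xi> \<omega>) A = ennreal (\<alpha> \<omega>) * emeasure \<mu> A"
    using diffuse_\<xi> AE_space
  proof eventually_elim
    case (elim \<omega>)
    show ?case
    proof
      fix A assume A: "A \<in> sets \<mu>"
      have part: "range (\<lambda>n. A \<inter> M n) \<subseteq> sets \<mu>" "disjoint_family (\<lambda>n. A \<inter> M n)" "(\<Union>n. A \<inter> M n) = A"
        using A tame_sets[OF Mn] M(2,3) sets.sets_into_space[OF A]
        by (auto simp: disjoint_family_on_def)
      \<comment> \<open>Since \<open>A\<close> need not be tame, its possibly infinite mass is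
        summed over the partition in the extended reals.\<close>
      have "emeasure (\<xi> \<omega>) A = (\<Sum>n. emeasure (\<xi> \<omega>) (A \<inter> M n))"
        using suminf_emeasure[of "\<lambda>n. A \<inter> M n" "\<xi> \<omega>"] part elim by (simp add: sets_\<xi>)
      also have "\<dots> = (\<Sum>n. ennreal (\<alpha> \<omega>) * emeasure \<mu> (A \<inter> M n))"
        using elim A Mn \<alpha>(2) by (intro suminf_cong emeasure_eq_scale_if_rational_cuts) auto
      also have "\<dots> = ennreal (\<alpha> \<omega>) * emeasure \<mu> A"
        using suminf_emeasure[of "\<lambda>n. A \<inter> M n" \<mu>] part by simp
      finally show "emeasure (\<xi> \<omega>) A = ennreal (\<alpha> \<omega>) * emeasure \<mu> A" .
    qed
  qed
  with \<alpha> show ?thesis by blast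
qed

end

section \<open>From the hypotheses of the theorem to the locale, and the converse\<close>

lemma borel_isomorphic_space_embedding:
  assumes "borel_isomorphic_space S"
  obtains f :: "'a \<Rightarrow> real" where "f \<in> borel_measurable S" "inj_on f (space S)" "f \<in> space S \<rightarrow> {0<..1}"
    "\<And>A. A \<in> sets S \<Longrightarrow> \<exists>C\<in>sets borel. A = f -` C \<inter> space S"
proof -
  obtain B g where B: "B \<in> sets borel" "B \<subseteq> {0..1::real}" "bij_betw g (space S) B"
    and g: "g \<in> measurable S (restrict_space borel B)"
    and h: "inv_into (space S) g \<in> measurable (restrict_space borel B) S"
    using assms unfolding borel_isomorphic_space_def by auto
  have g_borel[measurable]: "g \<in> borel_measurable S"
    using g by (simp add: measurable_restrict_space2_iff)
  have gB: "g x \<in> B" if "x \<in> space S" for x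
    using B(3) that by (auto simp: bij_betw_def)
  show thesis
    \<comment> \<open>The rescaling avoids the value 0, so that the half-open cells cover the range.\<close>
  proof (rule that[of "\<lambda>x. (g x + 1) / 2"])
    show "(\<lambda>x. (g x + 1) / 2) \<in> borel_measurable S" by measurable
    show "inj_on (\<lambda>x. (g x + 1) / 2) (space S)"
      using B(3) by (auto simp: bij_betw_def inj_on_def)
    show "(\<lambda>x. (g x + 1) / 2) \<in> space S \<rightarrow> {0<..1}"
      using gB B(2) by fastforce
    fix A assume A: "A \<in> sets S"
    \<comment> \<open>This is the image of \<open>A\<close> under \<open>g\<close>, written as a
      preimage under the inverse map, whose measurability makes it Borel.\<close>
    define D where "D = inv_into (space S) g -` A \<inter> B"
    have "D \<in> sets (restrict_space borel B)"
      using measurable_sets[OF h A] by (simp add: D_def space_restrict_space)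
    then have D: "D \<in> sets borel"
      using B(1) by (auto simp: sets_restrict_space)
    have eq: "2 * ((g x + 1) / 2) - 1 = g x" for x
      by (simp add: add_divide_distrib)
    have "A = (\<lambda>x. (g x + 1) / 2) -` ((\<lambda>y. 2 * y - 1) -` D) \<inter> space S"
      unfolding vimage_def mem_Collect_eq eq using sets.sets_into_space[OF A] gB B(3)
      by (auto simp: D_def bij_betw_def inv_into_f_f inj_on_eq_iff)
    moreover have "(\<lambda>y. 2 * y - 1) -` D \<in> sets borel"
      using measurable_sets_borel[of "\<lambda>y::real. 2 * y - 1" borel D] D by simp
    ultimately show "\<exists>C\<in>sets borel. A = (\<lambda>x. (g x + 1) / 2) -` C \<inter> space S" by blast
  qed
qed

text \<open>The only subsets of a singleton are itself and the empty set, so positive mass would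
  make it an atom.\<close>

lemma atomless_imp_emeasure_singleton:
  assumes "atomless \<mu>" "{s} \<in> sets \<mu>"
  shows "emeasure \<mu> {s} = 0"
proof (rule ccontr)
  assume "emeasure \<mu> {s} \<noteq> 0"
  then have "atom \<mu> {s}"
    using assms(2) by (auto simp: atom_def subset_singleton_iff zero_less_iff_neq_zero)
  with assms(1) show False by (auto simp: atomless_def)
qed

text \<open>Intersections of the members of two disjoint covers, enumerated through
  \<open>prod_decode\<close>. For \<open>\<mu>\<close> and the intensity measure this yields tame
  sets.\<close>

lemma sigma_finite_common_partition:
  assumes "sigma_finite_measure M" "sigma_finite_measure N" "sets M = sets N"
  obtains A :: "nat \<Rightarrow> 'a set" where "range A \<subseteq> sets M" "disjoint_family A" "(\<Union>n. A n) = space M"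
    "\<And>n. emeasure M (A n) < \<infinity>" "\<And>n. emeasure N (A n) < \<infinity>"
proof -
  obtain X :: "nat \<Rightarrow> 'a set" where X: "range X \<subseteq> sets M" "(\<Union>i. X i) = space M"
      "\<And>i. emeasure M (X i) \<noteq> \<infinity>" "disjoint_family X"
    by (rule sigma_finite_measure.sigma_finite_disjoint[OF assms(1)]) (rule that)
  obtain Y :: "nat \<Rightarrow> 'a set" where Y: "range Y \<subseteq> sets N" "(\<Union>i. Y i) = space N"
      "\<And>i. emeasure N (Y i) \<noteq> \<infinity>" "disjoint_family Y"
    by (rule sigma_finite_measure.sigma_finite_disjoint[OF assms(2)]) (rule that)
  define A where "A n = (case prod_decode n of (i, j) \<Rightarrow> X i \<inter> Y j)" for n
  have sets: "X i \<in> sets M" "Y i \<in> sets M" "X i \<in> sets N" "Y i \<in> sets N" for i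
    using X(1) Y(1) assms(3) by auto
  show thesis
  proof (rule that[of A])
    show "range A \<subseteq> sets M"
      using sets by (auto simp: A_def split: prod.split)
    show "disjoint_family A"
      unfolding disjoint_family_on_def
    proof (intro ballI impI)
      fix m n :: nat assume "m \<noteq> n"
      obtain i j i' j' where ij: "prod_decode m = (i, j)" "prod_decode n = (i', j')"
        by fastforce
      with \<open>m \<noteq> n\<close> have "(i, j) \<noteq> (i', j')" by (metis prod_decode_inverse)
      then have "X i \<inter> X i' = {} \<or> Y j \<inter> Y j' = {}"
        using X(4) Y(4) unfolding disjoint_family_on_def by blast
      then show "A m \<inter> A n = {}" using ij by (auto simp: A_def)
    qed
    show "(\<Union>n. A n) = space M"
    proof
      show "(\<Union>n. A n) \<subseteq> space M" using X(2) by (auto simp: A_def split: prod.splits)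
      show "space M \<subseteq> (\<Union>n. A n)"
      proof
        fix x assume "x \<in> space M"
        then obtain i j where "x \<in> X i" "x \<in> Y j"
          using X(2) Y(2) sets_eq_imp_space_eq[OF assms(3)] by blast
        then have "x \<in> A (prod_encode (i, j))" by (simp add: A_def)
        then show "x \<in> (\<Union>n. A n)" by blast
      qed
    qed
    show "emeasure M (A n) < \<infinity>" for n
    proof -
      obtain i j where "prod_decode n = (i, j)" by fastforce
      then have "emeasure M (A n) \<le> emeasure M (X i)"
        using sets by (intro emeasure_mono) (auto simp: A_def)
      then show ?thesis using X(3)[of i] by (auto simp: less_top[symmetric] top_unique)
    qed
    show "emeasure N (A n) < \<infinity>" for n
    proof -
      obtain i j where "prod_decode n = (i, j)" by fastforce
      then have "emeasure N (A n) \<le> emeasure N (Y j)"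
        using sets by (intro emeasure_mono) (auto simp: A_def)
      then show ?thesis using Y(3)[of j] by (auto simp: less_top[symmetric] top_unique)
    qed
  qed
qed

lemma swap_invariant_pair:
  assumes "swap_invariant P S \<mu> \<xi>"
    and "A \<in> sets S" "A' \<in> sets S" "B \<in> sets S" "B' \<in> sets S" "A \<inter> A' = {}" "B \<inter> B' = {}"
    and "emeasure \<mu> A = emeasure \<mu> B" "emeasure \<mu> A' = emeasure \<mu> B'"
    and "(\<integral>\<^sup>+ \<omega>. emeasure (\<xi> \<omega>) A \<partial>P) < \<infinity>" "(\<integral>\<^sup>+ \<omega>. emeasure (\<xi> \<omega>) A' \<partial>P) < \<infinity>"
    and "(\<integral>\<^sup>+ \<omega>. emeasure (\<xi> \<omega>) B \<partial>P) < \<infinity>" "(\<integral>\<^sup>+ \<omega>. emeasure (\<xi> \<omega>) B' \<partial>P) < \<infinity>"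
  shows "(\<integral>\<omega>. \<bar>measure (\<xi> \<omega>) A - measure (\<xi> \<omega>) A'\<bar> \<partial>P) = (\<integral>\<omega>. \<bar>measure (\<xi> \<omega>) B - measure (\<xi> \<omega>) B'\<bar> \<partial>P)"
proof -
  \<comment> \<open>The instance \<open>n = 2\<close>: the index 2 falls into the
    \<open>else\<close> branches.\<close>
  let ?u = "\<lambda>j. if j = (1::nat) then 1 else - 1 :: real"
  let ?A = "\<lambda>j. if j = (1::nat) then A else A'"
  let ?B = "\<lambda>j. if j = (1::nat) then B else B'"
  have two: "{1..2} = {1, 2::nat}" by auto
  have "disjoint_family_on ?A {1..2}" "disjoint_family_on ?B {1..2}"
    using assms(6,7) by (auto simp: disjoint_family_on_def two)
  with assms(2-5,8-) have "(\<integral>\<omega>. \<bar>\<Sum>j=1..2. ?u j * measure (\<xi> \<omega>) (?A j)\<bar> \<partial>P)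
      = (\<integral>\<omega>. \<bar>\<Sum>j=1..2. ?u j * measure (\<xi> \<omega>) (?B j)\<bar> \<partial>P)"
    using assms(1)[unfolded swap_invariant_def, THEN spec, of 2, THEN spec, of ?u,
      THEN spec, of ?A, THEN spec, of ?B]
    unfolding two by simp
  then show ?thesis unfolding two by simp
qed

text \<open>Outside one null event the \<open>\<xi>\<close>-mass of a set depends only on its
  \<open>\<mu>\<close>-mass, so the two integrands already agree almost surely.\<close>

lemma swap_invariant_if_random_multiple:
  assumes "random_measure P S \<xi>"
    and eq: "AE \<omega> in P. \<forall>M\<in>sets S. emeasure (\<xi> \<omega>) M = ennreal (\<alpha> \<omega>) * emeasure \<mu> M"
  shows "swap_invariant P S \<mu> \<xi>"
  unfolding swap_invariant_def
proof (intro allI impI)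
  fix n :: nat and u :: "nat \<Rightarrow> real" and A B
  assume AB: "\<forall>j\<in>{1..n}. A j \<in> sets S \<and> B j \<in> sets S"
    and e: "\<forall>j\<in>{1..n}. emeasure \<mu> (A j) = emeasure \<mu> (B j) \<and>
           (\<integral>\<^sup>+ \<omega>. emeasure (\<xi> \<omega>) (A j) \<partial>P) < \<infinity> \<and> (\<integral>\<^sup>+ \<omega>. emeasure (\<xi> \<omega>) (B j) \<partial>P) < \<infinity>"
  have meas: "(\<lambda>\<omega>. measure (\<xi> \<omega>) M) \<in> borel_measurable P" if "M \<in> sets S" for M
    using assms(1) that unfolding measure_def random_measure_def
    by (intro borel_measurable_enn2real) auto
  show "(\<integral>\<omega>. \<bar>\<Sum>j=1..n. u j * measure (\<xi> \<omega>) (A j)\<bar> \<partial>P) = (\<integral>\<omega>. \<bar>\<Sum>j=1..n. u j * measure (\<xi> \<omega>) (B j)\<bar> \<partial>P)"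
  proof (rule integral_cong_AE)
    show "(\<lambda>\<omega>. \<bar>\<Sum>j=1..n. u j * measure (\<xi> \<omega>) (A j)\<bar>) \<in> borel_measurable P"
      "(\<lambda>\<omega>. \<bar>\<Sum>j=1..n. u j * measure (\<xi> \<omega>) (B j)\<bar>) \<in> borel_measurable P"
      using AB by (auto intro!: borel_measurable_abs borel_measurable_sum borel_measurable_times meas)
    show "AE \<omega> in P. \<bar>\<Sum>j=1..n. u j * measure (\<xi> \<omega>) (A j)\<bar> = \<bar>\<Sum>j=1..n. u j * measure (\<xi> \<omega>) (B j)\<bar>"
      using eq
    proof eventually_elim
      case (elim \<omega>)
      \<comment> \<open>This includes the case of infinite mass, where both sides are 0.\<close>
      have "measure (\<xi> \<omega>) (A j) = measure (\<xi> \<omega>) (B j)" if "j \<in> {1..n}" for j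
        using elim AB e that by (simp add: measure_def)
      then show ?case by simp
    qed
  qed
qed

theorem theorem2p19:
  fixes P :: "'w measure" and S :: "'a measure" and \<mu> :: "'a measure"
    and \<xi> :: "'w \<Rightarrow> 'a measure"
  assumes "prob_space P"
    and "borel_isomorphic_space S"
    and "sets \<mu> = sets S"
    and "atomless \<mu>"
    and "sigma_finite_measure \<mu>"
    and "random_measure P S \<xi>"
    and "AE \<omega> in P. diffuse (\<xi> \<omega>)"
    and "sigma_finite_measure (intensity_measure P S \<xi>)"
  shows "swap_invariant P S \<mu> \<xi> \<longleftrightarrow>
    (\<exists>\<alpha> :: 'w \<Rightarrow> real. integrable P \<alpha> \<and> (\<forall>\<omega>\<in>space P. 0 \<le> \<alpha> \<omega>) \<and>
       (AE \<omega> in P. \<forall>M\<in>sets S. emeasure (\<xi> \<omega>) M = ennreal (\<alpha> \<omega>) * emeasure \<mu> M))"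
proof
  assume inv: "swap_invariant P S \<mu> \<xi>"
  have space: "space \<mu> = space S"
    using assms(3) by (rule sets_eq_imp_space_eq)
  obtain f :: "'a \<Rightarrow> real" where f: "f \<in> borel_measurable S" "inj_on f (space S)" "f \<in> space S \<rightarrow> {0<..1}"
    "\<And>A. A \<in> sets S \<Longrightarrow> \<exists>C\<in>sets borel. A = f -` C \<inter> space S"
    by (rule borel_isomorphic_space_embedding[OF assms(2)]) (rule that)
  \<comment> \<open>Atoms are measurable by definition, so atomlessness says something about
    singletons only once these are known to be measurable.\<close>
  have singleton: "{s} \<in> sets \<mu>" if "s \<in> space \<mu>" for s
  proof -
    have "{s} = f -` {f s} \<inter> space S"
      using f(2) that by (auto simp: inj_on_def space)
    also have "\<dots> \<in> sets S"
      using f(1) by (intro measurable_sets) auto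
    finally show ?thesis using assms(3) by simp
  qed
  note pair = swap_invariant_pair[OF inv, folded assms(3)]
  interpret swap_space P \<mu> \<xi> f
  proof
    show "inj_on f (space \<mu>)" "f \<in> space \<mu> \<rightarrow> {0<..1}"
      using f(2,3) space by simp_all
    show "sets (\<xi> \<omega>) = sets \<mu>" if "\<omega> \<in> space P" for \<omega>
      using assms(3,6) that by (simp add: random_measure_def)
    show "(\<lambda>\<omega>. emeasure (\<xi> \<omega>) A) \<in> borel_measurable P" if "A \<in> sets \<mu>" for A
      using assms(3,6) that by (simp add: random_measure_def)
    show "f \<in> borel_measurable \<mu>"
      using f(1) assms(3) by (simp cong: measurable_cong_sets)
    show "emeasure \<mu> {s} = 0" if "s \<in> space \<mu>" for s
      using assms(4) singleton[OF that] by (rule atomless_imp_emeasure_singleton)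
    show "AE \<omega> in P. diffuse (\<xi> \<omega>)" by fact
    show "\<exists>C\<in>sets borel. A = f -` C \<inter> space \<mu>" if "A \<in> sets \<mu>" for A
      using f(4) that assms(3) space by simp
  qed (rule pair; assumption)
  \<comment> \<open>Finite mass under the intensity measure means finite expected mass, so a
    partition that is finite for both measures consists of tame sets.\<close>
  obtain M :: "nat \<Rightarrow> 'a set" where M: "range M \<subseteq> sets \<mu>" "disjoint_family M" "(\<Union>n. M n) = space \<mu>"
    "\<And>n. emeasure \<mu> (M n) < \<infinity>" "\<And>n. emeasure (intensity_measure P S \<xi>) (M n) < \<infinity>"
  proof (rule sigma_finite_common_partition[OF assms(5,8)])
    show "sets \<mu> = sets (intensity_measure P S \<xi>)"
      using assms(3) by (simp add: intensity_measure_def)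
  qed (rule that)
  have "M n \<in> tame" for n
  proof -
    have Mn: "M n \<in> sets \<mu>" using M(1) by blast
    then show ?thesis
      using M(4,5)[of n] emeasure_intensity_measure[OF assms(6), of "M n"] assms(3)
      by (simp add: tame_def)
  qed
  then have "range M \<subseteq> tame" by blast
  from exists_random_multiple[OF this M(2,3)]
  show "\<exists>\<alpha> :: 'w \<Rightarrow> real. integrable P \<alpha> \<and> (\<forall>\<omega>\<in>space P. 0 \<le> \<alpha> \<omega>) \<and>
       (AE \<omega> in P. \<forall>M\<in>sets S. emeasure (\<xi> \<omega>) M = ennreal (\<alpha> \<omega>) * emeasure \<mu> M)"
    unfolding assms(3) .
next
  assume "\<exists>\<alpha> :: 'w \<Rightarrow> real. integrable P \<alpha> \<and> (\<forall>\<omega>\<in>space P. 0 \<le> \<alpha> \<omega>) \<and>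
       (AE \<omega> in P. \<forall>M\<in>sets S. emeasure (\<xi> \<omega>) M = ennreal (\<alpha> \<omega>) * emeasure \<mu> M)"
  then show "swap_invariant P S \<mu> \<xi>"
    by (elim exE conjE) (rule swap_invariant_if_random_multiple[OF assms(6)])
qed

end
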